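(* Let $D$ be an $m$-colored quasi-transitive digraph. Then $D$ has a $k$-colored kernel for every integer $k\geq 3$.
   Context: Digraphs are finite, nonempty, without loops or parallel arcs (pairs of opposite arcs are allowed); $V(D)$ and $A(D)$ denote the vertex and arc sets of $D$. A digraph $D$ is quasi-transitive if whenever $u_0,u_1,u_2$ are distinct vertices with $(u_0,u_1),(u_1,u_2)\in A(D)$, at least one of $(u_0,u_2)$, $(u_2,u_0)$ is in $A(D)$. A digraph $D$ is $m$-colored ($m$ a positive integer) if its arcs are colored with $m$ colors (each arc receives one color; no properness condition). Directed paths have no repeated vertices. For a positive integer $j$, a directed path is $j$-colored if its arcs use exactly $j$ colors; $u\leadsto_j v$ denotes a $j$-colored directed path from $u$ to $v$. For a positive integer $k$, a nonempty set $K\subseteq V(D)$ is a $k$-colored kernel of $D$ if it is both: (a) $k$-colored absorbent: for every $u\in V(D)\setminus K$ there exist $v\in K$ and $1\leq j\leq k$ with a path $u\leadsto_j v$ in $D$; and (b) $k$-colored independent: for all distinct $u,v\in K$ there is no path $u\leadsto_j v$ with $1\leq j\leq k$. *)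

theory Defs
  imports "Graph_Theory.Graph_Theory"
begin

definition quasi_transitive :: "('a, 'b) pre_digraph \<Rightarrow> bool" where
  "quasi_transitive D \<longleftrightarrow>
    (\<forall>u\<^sub>0 \<in> verts D. \<forall>u\<^sub>1 \<in> verts D. \<forall>u\<^sub>2 \<in> verts D.
      distinct [u\<^sub>0, u\<^sub>1, u\<^sub>2] \<and> u\<^sub>0 \<rightarrow>\<^bsub>D\<^esub> u\<^sub>1 \<and> u\<^sub>1 \<rightarrow>\<^bsub>D\<^esub> u\<^sub>2 \<longrightarrow>
      u\<^sub>0 \<rightarrow>\<^bsub>D\<^esub> u\<^sub>2 \<or> u\<^sub>2 \<rightarrow>\<^bsub>D\<^esub> u\<^sub>0)"

(* The colors are the numbers 1, ..., m; not every color has to be used. *)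
definition m_colored :: "nat \<Rightarrow> ('a, 'b) pre_digraph \<Rightarrow> ('b \<Rightarrow> nat) \<Rightarrow> bool" where
  "m_colored m D c \<longleftrightarrow> 1 \<le> m \<and> c ` arcs D \<subseteq> {1..m}"

definition colored_path ::
    "('a, 'b) pre_digraph \<Rightarrow> ('b \<Rightarrow> nat) \<Rightarrow> nat \<Rightarrow> 'a \<Rightarrow> 'a \<Rightarrow> bool" where
  "colored_path D c j u v \<longleftrightarrow> (\<exists>p. pre_digraph.apath D u p v \<and> card (c ` set p) = j)"

definition colored_absorbent ::
    "('a, 'b) pre_digraph \<Rightarrow> ('b \<Rightarrow> nat) \<Rightarrow> nat \<Rightarrow> 'a set \<Rightarrow> bool" where
  "colored_absorbent D c k K \<longleftrightarrow>
    (\<forall>u \<in> verts D - K. \<exists>v \<in> K. \<exists>j. 1 \<le> j \<and> j \<le> k \<and> colored_path D c j u v)"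

definition colored_independent ::
    "('a, 'b) pre_digraph \<Rightarrow> ('b \<Rightarrow> nat) \<Rightarrow> nat \<Rightarrow> 'a set \<Rightarrow> bool" where
  "colored_independent D c k K \<longleftrightarrow>
    (\<forall>u \<in> K. \<forall>v \<in> K. u \<noteq> v \<longrightarrow> \<not> (\<exists>j. 1 \<le> j \<and> j \<le> k \<and> colored_path D c j u v))"

definition colored_kernel ::
    "('a, 'b) pre_digraph \<Rightarrow> ('b \<Rightarrow> nat) \<Rightarrow> nat \<Rightarrow> 'a set \<Rightarrow> bool" where
  "colored_kernel D c k K \<longleftrightarrow>
    K \<noteq> {} \<and> K \<subseteq> verts D \<and> colored_absorbent D c k K \<and> colored_independent D c k K"

end

theory Submission
  imports Defs
begin

text \<open>
  Write \<open>u \<leadsto> v\<close> if there is a directed path from \<open>u\<close> to \<open>v\<close> with at least one and at most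
  \<open>k\<close> colors; for \<open>u \<noteq> v\<close> this says that \<open>u\<close> is absorbed by \<open>v\<close>.

  The colors matter very little, because in a quasi-transitive digraph long distances force
  arcs backwards: if the distance from \<open>u\<close> to \<open>v\<close> is at least 4, then \<open>v \<rightarrow> u\<close>
  (lemma \<open>quasi_transitive_arc_back_if_distance_ge_4\<close>). A path of length at most 3 uses at
  most \<open>3 \<le> k\<close> colors. So whenever \<open>v\<close> is reachable from \<open>u \<noteq> v\<close>, then
  \<open>u \<leadsto> v\<close> or \<open>v \<rightarrow> u\<close> (lemma \<open>reachable_few_colored_or_arc_back\<close>).

  Consequently absorption between reachable vertices can only fail against the direction of an
  arc. Call an arc \<open>u \<rightarrow> v\<close> one-way if not \<open>v \<leadsto> u\<close>. If \<open>x \<rightarrow> y\<close> is one-way and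
  \<open>y \<rightarrow> v\<close>, then \<open>v \<noteq> x\<close>, quasi-transitivity makes \<open>x\<close> and \<open>v\<close> adjacent, and \<open>v \<rightarrow> x\<close> is
  impossible, since it would give the path \<open>y \<rightarrow> v \<rightarrow> x\<close> with at most two colors; so \<open>x \<rightarrow> v\<close>.
  Hence everything reachable by one-way arcs is reachable by a single arc, and as there are
  no loops, the one-way arcs form an acyclic digraph (lemma \<open>acyclic_one_way\<close>).

  The kernel picks, in each strong component that no arc leaves, one vertex \<open>s\<close> from which no
  one-way arc starts. If \<open>u \<noteq> s\<close> reaches \<open>s\<close> and not \<open>u \<leadsto> s\<close>, then \<open>s \<rightarrow> u\<close>
  by the above, and this arc is one-way, against the choice of \<open>s\<close>. Since every vertex
  reaches such a component, the set is absorbent; it is independent because there is no path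
  at all between two of these components.
\<close>

section \<open>Distances in quasi-transitive digraphs\<close>

lemma quasi_transitive_arc_back:
  assumes "digraph D" "quasi_transitive D"
    and "x \<rightarrow>\<^bsub>D\<^esub> y" "y \<rightarrow>\<^bsub>D\<^esub> z" "x \<noteq> z" "\<not> x \<rightarrow>\<^bsub>D\<^esub> z"
  shows "z \<rightarrow>\<^bsub>D\<^esub> x"
proof -
  interpret digraph D by fact
  have "distinct [x, y, z]"
    using assms adj_not_same by auto
  then show ?thesis
    using assms adj_in_verts unfolding quasi_transitive_def by blast
qed

text \<open>
  Let \<open>u = x\<^sub>0, x\<^sub>1, \<dots>, x\<^sub>n = v\<close> be a shortest path. Quasi-transitivity gives arcs
  \<open>x\<^sub>i\<^sub>+\<^sub>2 \<rightarrow> x\<^sub>i\<close>, and then an arc from \<open>v\<close> to \<open>x\<^sub>2\<close> is enough, because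
  \<open>v \<rightarrow> x\<^sub>2 \<rightarrow> u\<close> makes \<open>v\<close> and \<open>u\<close> adjacent, and \<open>u \<rightarrow> v\<close> would be a shortcut.
  For \<open>n = 4\<close> the arc \<open>v \<rightarrow> x\<^sub>2\<close> is one of those arcs; for larger \<open>n\<close> induction gives
  \<open>v \<rightarrow> x\<^sub>1\<close>, and \<open>v \<rightarrow> x\<^sub>1 \<rightarrow> x\<^sub>2\<close> makes \<open>v\<close> and \<open>x\<^sub>2\<close> adjacent. At distance 3 the end
  vertices need not be adjacent.
\<close>
lemma quasi_transitive_arc_back_if_distance_ge_4:
  assumes "digraph D" "quasi_transitive D"
    and "4 \<le> n" "(u, v) \<in> arcs_ends D ^^ n" "\<And>i. i < n \<Longrightarrow> (u, v) \<notin> arcs_ends D ^^ i"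
  shows "v \<rightarrow>\<^bsub>D\<^esub> u"
  using assms(3-)
proof (induction n arbitrary: u rule: nat_induct_at_least)
  case base
  note rev_arc = quasi_transitive_arc_back[OF assms(1,2)]
  obtain x1 x2 x3 where x: "u \<rightarrow>\<^bsub>D\<^esub> x1" "x1 \<rightarrow>\<^bsub>D\<^esub> x2" "x2 \<rightarrow>\<^bsub>D\<^esub> x3" "x3 \<rightarrow>\<^bsub>D\<^esub> v"
    using base(1) by (auto simp: eval_nat_numeral)
  have short: "u \<noteq> v" "\<not> u \<rightarrow>\<^bsub>D\<^esub> v" "(u, v) \<notin> arcs_ends D O arcs_ends D"
      "(u, v) \<notin> arcs_ends D O arcs_ends D O arcs_ends D"
    using base(2)[of 0] base(2)[of 1] base(2)[of 2] base(2)[of 3]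
    by (simp_all add: eval_nat_numeral O_assoc)
  have "u \<noteq> x2" "\<not> u \<rightarrow>\<^bsub>D\<^esub> x2" "x2 \<noteq> v" "\<not> x2 \<rightarrow>\<^bsub>D\<^esub> v"
    using short x by blast+
  then have "x2 \<rightarrow>\<^bsub>D\<^esub> u" "v \<rightarrow>\<^bsub>D\<^esub> x2"
    using rev_arc[OF x(1,2)] rev_arc[OF x(3,4)] by blast+
  then show ?case
    using rev_arc[of v x2 u] short by blast
next
  case (Suc n)
  note rev_arc = quasi_transitive_arc_back[OF assms(1,2)]
  obtain x1 where x1: "u \<rightarrow>\<^bsub>D\<^esub> x1" "(x1, v) \<in> arcs_ends D ^^ n"
    using Suc.prems(1) by (meson relpow_Suc_E2)
  obtain l where n: "n = Suc l" "3 \<le> l"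
    using Suc.hyps by (cases n) auto
  obtain x2 where x2: "x1 \<rightarrow>\<^bsub>D\<^esub> x2" "(x2, v) \<in> arcs_ends D ^^ l"
    using x1(2) n(1) by (meson relpow_Suc_E2)
  have short1: "(x1, v) \<notin> arcs_ends D ^^ i" if "i < n" for i
    using Suc.prems(2)[of "Suc i"] that relpow_Suc_I2[OF x1(1)] by blast
  have short2: "(x2, v) \<notin> arcs_ends D ^^ i" if "i < l" for i
    using short1[of "Suc i"] that n(1) relpow_Suc_I2[OF x2(1)] by blast
  have "v \<rightarrow>\<^bsub>D\<^esub> x1"
    using Suc.IH x1(2) short1 by blast
  then have "v \<rightarrow>\<^bsub>D\<^esub> x2"
    using rev_arc[of v x1 x2] x2(1) short2[of 0] short2[of 1] n(2) by auto
  moreover have "x2 \<rightarrow>\<^bsub>D\<^esub> u"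
  proof (rule rev_arc[OF x1(1) x2(1)])
    show "u \<noteq> x2"
      using Suc.prems(2)[of l] x2(2) n(1) by auto
    show "\<not> u \<rightarrow>\<^bsub>D\<^esub> x2"
      using Suc.prems(2)[of "Suc l"] relpow_Suc_I2[OF _ x2(2)] n(1) by blast
  qed
  ultimately show ?case
    using rev_arc[of v x2 u] Suc.prems(2)[of 0] Suc.prems(2)[of 1] n by auto
qed

section \<open>Paths with few colors\<close>

definition few_colored_path ::
    "('a, 'b) pre_digraph \<Rightarrow> ('b \<Rightarrow> nat) \<Rightarrow> nat \<Rightarrow> 'a \<Rightarrow> 'a \<Rightarrow> bool" where
  "few_colored_path D c k u v \<longleftrightarrow> (\<exists>j. 1 \<le> j \<and> j \<le> k \<and> colored_path D c j u v)"

lemma (in wf_digraph) relpow_arcs_ends_awalk: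
  assumes "(u, v) \<in> arcs_ends G ^^ n" "u \<in> verts G"
  shows "\<exists>p. awalk u p v \<and> length p = n"
  using assms
proof (induction n arbitrary: u)
  case 0
  then show ?case by (auto simp: awalk_Nil_iff)
next
  case (Suc n)
  obtain x where x: "u \<rightarrow> x" "(x, v) \<in> arcs_ends G ^^ n"
    using Suc.prems(1) by (meson relpow_Suc_E2)
  obtain p where p: "awalk x p v" "length p = n"
    using Suc.IH[OF x(2) adj_in_verts(2)[OF x(1)]] by blast
  obtain e where "e \<in> arcs G" "tail G e = u" "head G e = x"
    using x(1) by (rule reachableE)
  then have "awalk u (e # p) v"
    using p(1) by (auto simp: awalk_Cons_iff)
  then show ?case
    using p(2) by (intro exI[of _ "e # p"]) simp
qed

lemma (in wf_digraph) few_colored_path_if_short_walk: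
  assumes "(u, v) \<in> arcs_ends G ^^ n" "n \<le> k" "u \<in> verts G" "u \<noteq> v"
  shows "few_colored_path G c k u v"
proof -
  obtain p where p: "awalk u p v" "length p = n"
    using relpow_arcs_ends_awalk assms by blast
  define q where "q = awalk_to_apath p"
  have q: "apath u q v" "set q \<subseteq> set p"
    unfolding q_def using p(1) by (rule apath_awalk_to_apath, rule awalk_to_apath_subset)
  have "q \<noteq> []"
    using q(1) \<open>u \<noteq> v\<close> by (auto simp: apath_def awalk_Nil_iff)
  then have "1 \<le> card (c ` set q)"
    by (simp add: Suc_le_eq card_gt_0_iff)
  moreover have "card (c ` set q) \<le> card (set p)"
    using card_image_le[of "set q" c] card_mono[of "set p" "set q"] q(2) by fastforce
  then have "card (c ` set q) \<le> k"
    using card_length[of p] p(2) assms(2) by linarith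
  ultimately show ?thesis
    using q(1) unfolding few_colored_path_def colored_path_def by blast
qed

lemma few_colored_path_reachable:
  assumes "digraph D" "few_colored_path D c k u v"
  shows "u \<rightarrow>\<^sup>*\<^bsub>D\<^esub> v"
proof -
  interpret digraph D by fact
  show ?thesis
    using assms(2) unfolding few_colored_path_def colored_path_def
    by (auto simp: reachable_apath)
qed

lemma reachable_few_colored_or_arc_back:
  assumes "digraph D" "quasi_transitive D" "3 \<le> k"
    and "u \<rightarrow>\<^sup>*\<^bsub>D\<^esub> v" "u \<noteq> v"
  shows "few_colored_path D c k u v \<or> v \<rightarrow>\<^bsub>D\<^esub> u"
proof -
  interpret digraph D by fact
  have "\<exists>n. (u, v) \<in> arcs_ends D ^^ n"
    using reachable_rtranclI[OF assms(4)] by (simp add: rtrancl_power)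
  then obtain n where n: "(u, v) \<in> arcs_ends D ^^ n" "\<And>i. i < n \<Longrightarrow> (u, v) \<notin> arcs_ends D ^^ i"
    using exists_least_iff[of "\<lambda>n. (u, v) \<in> arcs_ends D ^^ n"] by blast
  show ?thesis
  proof (cases "4 \<le> n")
    case True
    then show ?thesis
      using quasi_transitive_arc_back_if_distance_ge_4[OF assms(1,2) _ n] by blast
  next
    case False
    then show ?thesis
      using few_colored_path_if_short_walk[OF n(1)] assms(3-) reachable_in_verts by auto
  qed
qed

section \<open>One-way arcs\<close>

definition one_way :: "('a, 'b) pre_digraph \<Rightarrow> ('b \<Rightarrow> nat) \<Rightarrow> nat \<Rightarrow> 'a rel" where
  "one_way D c k = {(u, v). u \<rightarrow>\<^bsub>D\<^esub> v \<and> \<not> few_colored_path D c k v u}"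

text \<open>
  The arc \<open>v \<rightarrow> x\<close>, which quasi-transitivity would offer instead, closes a path \<open>y \<rightarrow> v \<rightarrow> x\<close>
  of length 2, against \<open>x \<rightarrow> y\<close> being one-way. The case \<open>v = x\<close> is excluded in the same way by
  the path \<open>y \<rightarrow> x\<close>. The conclusion can serve as the second hypothesis again, so the lemma
  iterates along a walk of one-way arcs, starting at its end.
\<close>
lemma one_way_arc_trans:
  assumes "digraph D" "quasi_transitive D" "2 \<le> k"
    and "(x, y) \<in> one_way D c k" "y \<rightarrow>\<^bsub>D\<^esub> v"
  shows "x \<rightarrow>\<^bsub>D\<^esub> v"
proof (rule ccontr)
  assume no_arc: "\<not> x \<rightarrow>\<^bsub>D\<^esub> v"
  interpret digraph D by fact
  have xy: "x \<rightarrow>\<^bsub>D\<^esub> y" "\<not> few_colored_path D c k y x"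
    using assms(4) unfolding one_way_def by auto
  have y: "y \<in> verts D" "y \<noteq> x"
    using xy(1) adj_in_verts adj_not_same by auto
  have "x \<noteq> v"
    using few_colored_path_if_short_walk[of y x 1 k] assms(3,5) xy(2) y by auto
  then have "v \<rightarrow>\<^bsub>D\<^esub> x"
    using quasi_transitive_arc_back[OF assms(1,2) xy(1) assms(5)] no_arc by blast
  then have "(y, x) \<in> arcs_ends D ^^ 2"
    using assms(5) by (auto simp: eval_nat_numeral)
  then show False
    using few_colored_path_if_short_walk assms(3) xy(2) y by blast
qed

lemma acyclic_one_way:
  assumes "digraph D" "quasi_transitive D" "2 \<le> k"
  shows "acyclic (one_way D c k)"
proof -
  interpret digraph D by fact
  have "x \<rightarrow>\<^bsub>D\<^esub> v" if "(x, v) \<in> (one_way D c k)\<^sup>+" for x v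
    using that
  proof (induction rule: converse_trancl_induct)
    case (base x)
    then show ?case by (simp add: one_way_def)
  next
    case (step x y)
    then show ?case using one_way_arc_trans[OF assms] by blast
  qed
  then show ?thesis
    unfolding acyclic_def using adj_not_same by blast
qed

lemma one_way_sink_in_reachable_set:
  assumes "digraph D" "quasi_transitive D" "2 \<le> k" "t \<in> verts D"
  shows "\<exists>s. t \<rightarrow>\<^sup>*\<^bsub>D\<^esub> s \<and> s \<notin> Domain (one_way D c k)"
proof -
  interpret digraph D by fact
  have "one_way D c k \<subseteq> verts D \<times> verts D"
    using adj_in_verts by (auto simp: one_way_def)
  then have "finite (one_way D c k)"
    by (rule finite_subset) simp
  then have "wf ((one_way D c k)\<inverse>)"
    using acyclic_one_way[OF assms(1-3)] by (rule finite_acyclic_wf_converse)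
  then obtain s where s: "t \<rightarrow>\<^sup>*\<^bsub>D\<^esub> s"
      "\<And>v. (v, s) \<in> (one_way D c k)\<inverse> \<Longrightarrow> \<not> t \<rightarrow>\<^sup>*\<^bsub>D\<^esub> v"
    using wfE_min[of _ t "{s. t \<rightarrow>\<^sup>*\<^bsub>D\<^esub> s}"] assms(4) reachable_refl
    by (metis mem_Collect_eq)
  have "s \<notin> Domain (one_way D c k)"
    using s reachable_adj_trans by (auto simp: one_way_def)
  then show ?thesis
    using s(1) by blast
qed

text \<open>
  The only alternative is the arc \<open>s \<rightarrow> u\<close>; it is not one-way, which again gives a path
  with few colors from \<open>u\<close> to \<open>s\<close>.
\<close>
lemma reachable_one_way_sink_few_colored:
  assumes "digraph D" "quasi_transitive D" "3 \<le> k"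
    and "s \<notin> Domain (one_way D c k)"
    and "u \<rightarrow>\<^sup>*\<^bsub>D\<^esub> s" "u \<noteq> s"
  shows "few_colored_path D c k u s"
  using reachable_few_colored_or_arc_back[OF assms(1-3,5,6)] assms(4)
  by (auto simp: one_way_def)

section \<open>Terminal strong components\<close>

text \<open>
  A vertex is terminal if its strong component is left by no arc. The component is then the
  set of all vertices reachable from it.
\<close>
definition terminal_vertices :: "('a, 'b) pre_digraph \<Rightarrow> 'a set" where
  "terminal_vertices D = {t \<in> verts D. \<forall>v. t \<rightarrow>\<^sup>*\<^bsub>D\<^esub> v \<longrightarrow> v \<rightarrow>\<^sup>*\<^bsub>D\<^esub> t}"

lemma (in fin_digraph) reachable_terminal_vertex:
  assumes "u \<in> verts G"
  shows "\<exists>t \<in> terminal_vertices G. u \<rightarrow>\<^sup>* t"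
proof -
  define reach where "reach v = {w. v \<rightarrow>\<^sup>* w}" for v
  have fin: "finite (reach v)" for v
    by (rule finite_subset[of _ "verts G"]) (auto simp: reach_def reachable_in_verts)
  \<comment> \<open>Moving along an arc can only shrink the set of reachable vertices, and it
    strictly shrinks it when the arc leaves the strong component.\<close>
  obtain t where t: "u \<rightarrow>\<^sup>* t" "\<And>w. u \<rightarrow>\<^sup>* w \<Longrightarrow> card (reach t) \<le> card (reach w)"
    using ex_has_least_nat[of "\<lambda>t. u \<rightarrow>\<^sup>* t" u "\<lambda>t. card (reach t)"] assms by blast
  have "w \<rightarrow>\<^sup>* t" if w: "t \<rightarrow>\<^sup>* w" for w
  proof -
    have "reach w \<subseteq> reach t"
      using w reachable_trans by (auto simp: reach_def)
    then have "reach w = reach t"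
      using t(2)[OF reachable_trans[OF t(1) w]] fin card_seteq by metis
    then show ?thesis
      using t(1) reachable_in_verts by (auto simp: reach_def)
  qed
  then have "t \<in> terminal_vertices G"
    using reachable_in_verts(2)[OF t(1)] by (simp add: terminal_vertices_def)
  then show ?thesis
    using t(1) by blast
qed

lemma (in wf_digraph) terminal_reachable_set_eq:
  assumes "t \<in> terminal_vertices G" "t \<rightarrow>\<^sup>* v"
  shows "{w. v \<rightarrow>\<^sup>* w} = {w. t \<rightarrow>\<^sup>* w}"
  using assms reachable_trans unfolding terminal_vertices_def by blast

section \<open>The kernel\<close>

theorem theorem14:
  fixes D :: "('a, 'b) pre_digraph" and c :: "'b \<Rightarrow> nat" and m k :: nat
  assumes "digraph D" and "verts D \<noteq> {}"
    and "m_colored m D c"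
    and "quasi_transitive D"
    and "3 \<le> k"
  shows "\<exists>K. colored_kernel D c k K"
proof -
  interpret digraph D by fact
  define reach where "reach t = {v. t \<rightarrow>\<^sup>*\<^bsub>D\<^esub> v}" for t
  define sink where "sink C = (SOME s. s \<in> C \<and> s \<notin> Domain (one_way D c k))" for C
  \<comment> \<open>The chosen sink depends on \<open>t\<close> only through \<open>reach t\<close>, which is the strong component
    of \<open>t\<close> when \<open>t\<close> is terminal; so each of these components contributes one vertex.\<close>
  define K where "K = (\<lambda>t. sink (reach t)) ` terminal_vertices D"
  have sink: "t \<rightarrow>\<^sup>*\<^bsub>D\<^esub> sink (reach t)" "sink (reach t) \<notin> Domain (one_way D c k)"
    if "t \<in> terminal_vertices D" for t
  proof -
    have "\<exists>s. s \<in> reach t \<and> s \<notin> Domain (one_way D c k)"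
      using one_way_sink_in_reachable_set[OF assms(1,4), of k t c] that assms(5)
      by (auto simp: reach_def terminal_vertices_def)
    then have "sink (reach t) \<in> reach t \<and> sink (reach t) \<notin> Domain (one_way D c k)"
      unfolding sink_def by (rule someI_ex)
    then show "t \<rightarrow>\<^sup>*\<^bsub>D\<^esub> sink (reach t)" "sink (reach t) \<notin> Domain (one_way D c k)"
      by (auto simp: reach_def)
  qed
  have "K \<noteq> {}"
    using assms(2) reachable_terminal_vertex by (auto simp: K_def)
  moreover have "K \<subseteq> verts D"
    using sink(1) reachable_in_verts(2) by (fastforce simp: K_def)
  moreover have "colored_absorbent D c k K"
    unfolding colored_absorbent_def
  proof
    fix u assume u: "u \<in> verts D - K"
    obtain t where t: "t \<in> terminal_vertices D" "u \<rightarrow>\<^sup>*\<^bsub>D\<^esub> t"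
      using u reachable_terminal_vertex by blast
    let ?s = "sink (reach t)"
    have "?s \<in> K"
      using t(1) by (auto simp: K_def)
    moreover have "few_colored_path D c k u ?s"
      using reachable_one_way_sink_few_colored[OF assms(1,4,5) sink(2)[OF t(1)]]
        reachable_trans[OF t(2) sink(1)[OF t(1)]] u \<open>?s \<in> K\<close> by blast
    ultimately show "\<exists>v \<in> K. \<exists>j. 1 \<le> j \<and> j \<le> k \<and> colored_path D c j u v"
      unfolding few_colored_path_def by blast
  qed
  moreover have "colored_independent D c k K"
    unfolding colored_independent_def
  proof (intro ballI impI)
    fix u v assume uv: "u \<in> K" "v \<in> K" "u \<noteq> v"
    obtain s t where s: "s \<in> terminal_vertices D" "u = sink (reach s)"
      and t: "t \<in> terminal_vertices D" "v = sink (reach t)"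
      using uv by (auto simp: K_def)
    have "\<not> u \<rightarrow>\<^sup>*\<^bsub>D\<^esub> v"
    proof
      assume "u \<rightarrow>\<^sup>*\<^bsub>D\<^esub> v"
      then have "s \<rightarrow>\<^sup>*\<^bsub>D\<^esub> v" "t \<rightarrow>\<^sup>*\<^bsub>D\<^esub> v"
        using sink(1)[OF s(1)] sink(1)[OF t(1)] s(2) t(2) reachable_trans by auto
      then have "reach s = reach t"
        using terminal_reachable_set_eq[OF s(1)] terminal_reachable_set_eq[OF t(1)]
        unfolding reach_def by blast
      then show False
        using uv(3) s(2) t(2) by simp
    qed
    then show "\<not> (\<exists>j. 1 \<le> j \<and> j \<le> k \<and> colored_path D c j u v)"
      using few_colored_path_reachable[OF assms(1)] unfolding few_colored_path_def by blast
  qed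
  ultimately show ?thesis
    unfolding colored_kernel_def by blast
qed

end
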